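(* For any graph $G$, any $k\in\mathbb{N}$ and any $t_1,\dots,t_k\in\mathbb{N}$, $$\alpha_{t}^{DP}(G)\le\sum_{i=1}^k\alpha_{t_i}^{DP}(G),\qquad\text{where } t=\sum_{i=1}^k t_i.$$
   Context: All graphs are nonempty, finite and simple; $\mathbb{N}=\{1,2,\dots\}$. For $S,U\subseteq V(H)$, $E_H(S,U)$ is the set of edges of $H$ with at least one endpoint in $S$ and at least one endpoint in $U$. A cover of a graph $G$ is a pair $\mathcal{H}=(L,H)$ where $H$ is a graph and $L:V(G)\to\mathcal{P}(V(H))$ satisfies: (1) the sets $L(u)$, $u\in V(G)$, partition $V(H)$; (2) $H[L(u)]$ is complete for every $u\in V(G)$; (3) for every $uv\in E(G)$, $E_H(L(u),L(v))$ is a (possibly empty) matching; (4) if $u\neq v$ and $uv\notin E(G)$, then $E_H(L(u),L(v))=\emptyset$. The cover is $m$-fold if $|L(u)|=m$ for all $u\in V(G)$. For $t\in\mathbb{N}$, the partial DP $t$-chromatic number $\alpha_t^{DP}(G)$ is the minimum of $\alpha(H)$ (the independence number of $H$) over all $t$-fold covers $\mathcal{H}=(L,H)$ of $G$. *)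

theory Defs
  imports
    "HOL-Library.Disjoint_Sets"
    "HOL-Library.Ramsey"
    "Graph_Theory.Graph_Theory"
begin

text \<open>
  A simple graph is a \<^locale>\<open>pair_graph\<close>: a finite symmetric loop-free relation on a finite vertex
  set. Its undirected edges are the two-element sets \<open>{u, v}\<close> with \<open>(u, v)\<close> (and hence \<open>(v, u)\<close>)
  an arc; \<^const>\<open>clique\<close> and \<^const>\<open>indep\<close> are applied to this set of edges.
\<close>

definition simple_graph :: "'a pair_pre_digraph \<Rightarrow> bool" where
  "simple_graph G \<longleftrightarrow> pair_graph G \<and> pverts G \<noteq> {}"

definition uedges :: "'a pair_pre_digraph \<Rightarrow> 'a set set" where
  "uedges G = {{u, v} |u v. (u, v) \<in> parcs G}"

definition edges_between :: "'a pair_pre_digraph \<Rightarrow> 'a set \<Rightarrow> 'a set \<Rightarrow> 'a set set" where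
  "edges_between H S U = {e \<in> uedges H. e \<inter> S \<noteq> {} \<and> e \<inter> U \<noteq> {}}"

definition independence_number :: "'a pair_pre_digraph \<Rightarrow> nat" where
  "independence_number H = Max {card I |I. I \<subseteq> pverts H \<and> indep I (uedges H)}"

text \<open>
  The values of \<open>L\<close> outside the vertices of \<open>G\<close> are irrelevant. A set of edges is a matching iff its
  members are pairwise disjoint.
\<close>

definition cover :: "'a pair_pre_digraph \<Rightarrow> ('a \<Rightarrow> 'b set) \<Rightarrow> 'b pair_pre_digraph \<Rightarrow> bool" where
  "cover G L H \<longleftrightarrow>
     simple_graph H \<and>
     (\<Union>u\<in>pverts G. L u) = pverts H \<and> disjoint_family_on L (pverts G) \<and>
     (\<forall>u\<in>pverts G. clique (L u) (uedges H)) \<and>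
     (\<forall>u v. (u, v) \<in> parcs G \<longrightarrow> disjoint (edges_between H (L u) (L v))) \<and>
     (\<forall>u\<in>pverts G. \<forall>v\<in>pverts G.
        u \<noteq> v \<and> (u, v) \<notin> parcs G \<longrightarrow> edges_between H (L u) (L v) = {})"

definition fold_cover ::
  "nat \<Rightarrow> 'a pair_pre_digraph \<Rightarrow> ('a \<Rightarrow> 'b set) \<Rightarrow> 'b pair_pre_digraph \<Rightarrow> bool" where
  "fold_cover m G L H \<longleftrightarrow> cover G L H \<and> (\<forall>u\<in>pverts G. card (L u) = m)"

text \<open>
  The minimum ranges over covers whose graph has vertices in \<^typ>\<open>nat\<close>. This is no restriction, as
  every finite graph is isomorphic to one on natural numbers: see \<open>partial_DP_le\<close> below for covers
  over an arbitrary vertex type, and \<open>partial_DP_attained\<close> for the fact that the minimum exists.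
\<close>

definition partial_DP :: "nat \<Rightarrow> 'a pair_pre_digraph \<Rightarrow> nat" where
  "partial_DP t G =
     (LEAST n. \<exists>(L :: 'a \<Rightarrow> nat set) H. fold_cover t G L H \<and> independence_number H = n)"

lemma simple_graph_iff:
  "simple_graph G \<longleftrightarrow> finite (pverts G) \<and> pverts G \<noteq> {} \<and> parcs G \<subseteq> pverts G \<times> pverts G \<and>
     sym (parcs G) \<and> irrefl (parcs G)"
proof
  assume "simple_graph G"
  then interpret pair_graph G
    by (simp add: simple_graph_def)
  show "finite (pverts G) \<and> pverts G \<noteq> {} \<and> parcs G \<subseteq> pverts G \<times> pverts G \<and>
     sym (parcs G) \<and> irrefl (parcs G)"
    using \<open>simple_graph G\<close> pair_finite_verts wellformed' pair_sym_arcs pair_no_loops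
    by (fastforce simp: simple_graph_def symmetric_def irrefl_def)
next
  assume G: "finite (pverts G) \<and> pverts G \<noteq> {} \<and> parcs G \<subseteq> pverts G \<times> pverts G \<and>
     sym (parcs G) \<and> irrefl (parcs G)"
  then have "finite (parcs G)"
    using finite_subset by blast
  with G have "pair_graph G"
    by unfold_locales (auto simp: symmetric_def irrefl_def)
  with G show "simple_graph G"
    by (simp add: simple_graph_def)
qed

lemma uedges_iff: "simple_graph G \<Longrightarrow> {u, v} \<in> uedges G \<longleftrightarrow> (u, v) \<in> parcs G"
  by (auto simp: uedges_def simple_graph_iff doubleton_eq_iff dest: symD)

lemma uedgesD: "simple_graph H \<Longrightarrow> e \<in> uedges H \<Longrightarrow> e \<subseteq> pverts H"
  by (auto simp: uedges_def simple_graph_iff)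

context
  fixes H :: "'b pair_pre_digraph" and H' :: "'c pair_pre_digraph" and f :: "'b \<Rightarrow> 'c"
  assumes H: "simple_graph H" and inj: "inj_on f (pverts H)"
    and H': "H' = \<lparr>pverts = f ` pverts H, parcs = map_prod f f ` parcs H\<rparr>"
begin

lemma simple_graph_rename: "simple_graph H'"
proof -
  have V: "u \<in> pverts H \<and> v \<in> pverts H" if "(u, v) \<in> parcs H" for u v
    using H that by (auto simp: simple_graph_iff)
  have "sym (parcs H')"
  proof (rule symI)
    fix x y assume "(x, y) \<in> parcs H'"
    then obtain u v where "x = f u" "y = f v" "(u, v) \<in> parcs H"
      by (auto simp: H')
    moreover from this have "(v, u) \<in> parcs H"
      using H by (auto simp: simple_graph_iff dest: symD)
    ultimately show "(y, x) \<in> parcs H'"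
      by (force simp: H')
  qed
  moreover have "(x, x) \<notin> parcs H'" for x
  proof
    assume "(x, x) \<in> parcs H'"
    then obtain u v where uv: "f u = f v" "(u, v) \<in> parcs H"
      by (auto simp: H')
    then have "u = v"
      using V inj by (blast dest: inj_onD)
    then show False
      using H uv by (auto simp: simple_graph_iff irrefl_def)
  qed
  moreover have "parcs H' \<subseteq> pverts H' \<times> pverts H'"
    using V by (auto simp: H')
  ultimately show ?thesis
    using H by (auto simp: simple_graph_iff irrefl_def H')
qed

lemma uedges_rename: "uedges H' = image f ` uedges H"
proof -
  have "uedges H = (\<lambda>(u, v). {u, v}) ` parcs H" "uedges H' = (\<lambda>(u, v). {u, v}) ` parcs H'"
    by (auto simp: uedges_def)
  then show ?thesis
    by (simp add: H' image_image case_prod_unfold)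
qed

lemma uedges_rename_iff:
  assumes "x \<in> pverts H" "y \<in> pverts H"
  shows "{f x, f y} \<in> uedges H' \<longleftrightarrow> {x, y} \<in> uedges H"
proof -
  have "{f x, f y} \<in> uedges H' \<longleftrightarrow> f ` {x, y} \<in> image f ` uedges H"
    by (simp add: uedges_rename)
  also have "\<dots> \<longleftrightarrow> {x, y} \<in> uedges H"
  proof
    assume "f ` {x, y} \<in> image f ` uedges H"
    then obtain e where e: "e \<in> uedges H" "f ` {x, y} = f ` e"
      by blast
    then have "{x, y} = e"
      using inj_on_image_eq_iff[OF inj, of "{x, y}" e] uedgesD[OF H] assms by blast
    with e show "{x, y} \<in> uedges H"
      by simp
  qed blast
  finally show ?thesis .
qed

lemma edges_between_rename:
  assumes "S \<subseteq> pverts H" "U \<subseteq> pverts H"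
  shows "edges_between H' (f ` S) (f ` U) = image f ` edges_between H S U"
proof -
  have "f ` e \<inter> f ` T \<noteq> {} \<longleftrightarrow> e \<inter> T \<noteq> {}" if "e \<in> uedges H" "T \<subseteq> pverts H" for e T
    using inj_on_image_Int[OF inj, of e T] uedgesD[OF H that(1)] that(2) by auto
  then have "{e \<in> uedges H. f ` e \<inter> f ` S \<noteq> {} \<and> f ` e \<inter> f ` U \<noteq> {}} = edges_between H S U"
    using assms by (simp add: edges_between_def cong: conj_cong)
  moreover have "edges_between H' (f ` S) (f ` U) =
      image f ` {e \<in> uedges H. f ` e \<inter> f ` S \<noteq> {} \<and> f ` e \<inter> f ` U \<noteq> {}}"
    by (simp only: edges_between_def uedges_rename) blast
  ultimately show ?thesis
    by simp
qed

lemma independence_number_rename: "independence_number H' = independence_number H"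
proof -
  have I: "indep (f ` I) (uedges H') \<longleftrightarrow> indep I (uedges H)" if "I \<subseteq> pverts H" for I
  proof -
    have "f x = f y \<longleftrightarrow> x = y" "{f x, f y} \<in> uedges H' \<longleftrightarrow> {x, y} \<in> uedges H"
      if "x \<in> I" "y \<in> I" for x y
      using that \<open>I \<subseteq> pverts H\<close> inj_on_eq_iff[OF inj] uedges_rename_iff by blast+
    then show ?thesis
      by (simp add: indep_def cong: ball_cong)
  qed
  have c: "card (f ` I) = card I" if "I \<subseteq> pverts H" for I
    using card_image inj inj_on_subset that by blast
  have "{card I |I. I \<subseteq> pverts H' \<and> indep I (uedges H')}
      = {card (f ` I) |I. I \<subseteq> pverts H \<and> indep (f ` I) (uedges H')}"
    by (auto simp: H' subset_image_iff)
  also have "\<dots> = {card I |I. I \<subseteq> pverts H \<and> indep I (uedges H)}"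
    by (intro Collect_cong ex_cong1) (auto simp: I c)
  finally show ?thesis
    by (simp add: independence_number_def)
qed

lemma fold_cover_rename:
  assumes G: "simple_graph G" and "fold_cover m G L H"
  shows "fold_cover m G (\<lambda>u. f ` L u) H'"
proof -
  have L: "L u \<subseteq> pverts H" if "u \<in> pverts G" for u
    using assms that by (auto simp: fold_cover_def cover_def)
  have cov: "cover G L H"
    using assms by (simp add: fold_cover_def)
  have V: "(\<Union>u\<in>pverts G. f ` L u) = pverts H'"
    using cov by (simp add: cover_def H' flip: image_UN)
  have D: "disjoint_family_on (\<lambda>u. f ` L u) (pverts G)"
    unfolding disjoint_family_on_def
  proof (intro ballI impI)
    fix u v assume "u \<in> pverts G" "v \<in> pverts G" "u \<noteq> v"
    then show "f ` L u \<inter> f ` L v = {}"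
      using cov inj_on_image_Int[OF inj L L, of u v] by (auto simp: cover_def disjoint_family_on_def)
  qed
  have C: "clique (f ` L u) (uedges H')" if "u \<in> pverts G" for u
    unfolding clique_def
  proof (intro ballI impI)
    fix x y assume "x \<in> f ` L u" "y \<in> f ` L u" "x \<noteq> y"
    then obtain a b where ab: "x = f a" "y = f b" "a \<in> L u" "b \<in> L u" "a \<noteq> b"
      by auto
    then have "{a, b} \<in> uedges H"
      using cov that by (auto simp: cover_def clique_def)
    then show "{x, y} \<in> uedges H'"
      using ab L[OF that] by (simp add: uedges_rename_iff subset_iff)
  qed
  have M: "disjoint (edges_between H' (f ` L u) (f ` L v))" if uv: "(u, v) \<in> parcs G" for u v
  proof -
    have "u \<in> pverts G" "v \<in> pverts G"
      using G uv by (auto simp: simple_graph_iff)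
    then have eq: "edges_between H' (f ` L u) (f ` L v) = image f ` edges_between H (L u) (L v)"
      by (simp add: edges_between_rename L)
    have "disjoint (edges_between H (L u) (L v))"
      using cov uv by (auto simp: cover_def)
    then have d: "p \<inter> q = {}" if "p \<in> edges_between H (L u) (L v)"
        "q \<in> edges_between H (L u) (L v)" "p \<noteq> q" for p q
      using that by (simp add: disjoint_def)
    show ?thesis
      unfolding disjoint_def eq
    proof (clarify)
      fix p q
      assume p: "p \<in> edges_between H (L u) (L v)" and q: "q \<in> edges_between H (L u) (L v)"
        and "f ` p \<noteq> f ` q"
      then have "p \<subseteq> pverts H" "q \<subseteq> pverts H" "p \<inter> q = {}"
        using uedgesD[OF H] d[OF p q] by (auto simp: edges_between_def)
      then show "f ` p \<inter> f ` q = {}"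
        using inj_on_image_Int[OF inj, of p q] by simp
    qed
  qed
  have N: "edges_between H' (f ` L u) (f ` L v) = {}"
    if "u \<in> pverts G" "v \<in> pverts G" "u \<noteq> v" "(u, v) \<notin> parcs G" for u v
    using that cov by (simp add: edges_between_rename L cover_def)
  have K: "card (f ` L u) = m" if "u \<in> pverts G" for u
    using that assms(2) card_image[OF inj_on_subset[OF inj L[OF that]]]
    by (simp add: fold_cover_def)
  show ?thesis
    using V D C M N K simple_graph_rename by (simp add: fold_cover_def cover_def)
qed

end

lemma ex_fold_cover:
  assumes G: "simple_graph G" and t: "t \<ge> 1"
  shows "\<exists>(L :: 'a \<Rightarrow> ('a \<times> nat) set) H. fold_cover t (G :: 'a pair_pre_digraph) L H"
proof (intro exI)
  define H where "H = \<lparr>pverts = pverts G \<times> {..<t},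
    parcs = {((u, i), (u, j)) |u i j. u \<in> pverts G \<and> i < t \<and> j < t \<and> i \<noteq> j}\<rparr>"
  have H: "simple_graph H"
    using G t by (auto simp: simple_graph_iff H_def sym_def irrefl_def lessThan_empty_iff)
  have E: "edges_between H ({u} \<times> {..<t}) ({v} \<times> {..<t}) = {}" if "u \<noteq> v" for u v
    using that by (auto simp: edges_between_def uedges_def H_def)
  have C: "clique ({u} \<times> {..<t}) (uedges H)" if "u \<in> pverts G" for u
    using that uedges_iff[OF H] by (auto simp: clique_def H_def)
  have ne: "u \<noteq> v" if "(u, v) \<in> parcs G" for u v
    using that G by (auto simp: simple_graph_iff irrefl_def)
  show "fold_cover t G (\<lambda>u. {u} \<times> {..<t}) H"
    unfolding fold_cover_def cover_def
    using H C E ne by (auto simp: H_def disjoint_family_on_def)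
qed

lemma partial_DP_le:
  fixes G :: "'a pair_pre_digraph" and H :: "'b pair_pre_digraph"
  assumes G: "simple_graph G" and c: "fold_cover t G L H"
  shows "partial_DP t G \<le> independence_number H"
proof -
  have H: "simple_graph H"
    using c by (simp add: fold_cover_def cover_def)
  obtain f :: "'b \<Rightarrow> nat" where f: "inj_on f (pverts H)"
    using finite_imp_inj_to_nat_seg[of "pverts H"] H by (auto simp: simple_graph_iff)
  show ?thesis
    unfolding partial_DP_def
    using fold_cover_rename[OF H f refl G c] independence_number_rename[OF H f refl]
    by (intro Least_le) blast
qed

lemma partial_DP_attained:
  fixes G :: "'a pair_pre_digraph"
  assumes G: "simple_graph G" and t: "t \<ge> 1"
  shows "\<exists>(L :: 'a \<Rightarrow> nat set) H. fold_cover t G L H \<and> independence_number H = partial_DP t G"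
proof -
  obtain L :: "'a \<Rightarrow> ('a \<times> nat) set" and H where c: "fold_cover t G L H"
    using ex_fold_cover[OF G t] by blast
  then have H: "simple_graph H"
    by (simp add: fold_cover_def cover_def)
  obtain f :: "'a \<times> nat \<Rightarrow> nat" where f: "inj_on f (pverts H)"
    using finite_imp_inj_to_nat_seg[of "pverts H"] H by (auto simp: simple_graph_iff)
  have "\<exists>n. \<exists>(L :: 'a \<Rightarrow> nat set) H. fold_cover t G L H \<and> independence_number H = n"
    using fold_cover_rename[OF H f refl G c] by blast
  then show ?thesis
    unfolding partial_DP_def by (rule LeastI_ex)
qed

end

theory Submission
  imports Defs
begin

text \<open>
  Take for each \<open>i\<close> an optimal \<open>t\<^sub>i\<close>-fold cover \<open>(L\<^sub>i, H\<^sub>i)\<close>, form the disjoint union of the \<open>H\<^sub>i\<close> and join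
  \<open>L\<^sub>i(u)\<close> completely to \<open>L\<^sub>j(u)\<close> for all \<open>u\<close> and all \<open>i \<noteq> j\<close>. No new edge runs between the fibres of
  distinct vertices, so this is a \<open>t\<close>-fold cover; and an independent set of it meets each \<open>H\<^sub>i\<close> in an
  independent set.
\<close>

lemma finite_indep_cards:
  "simple_graph H \<Longrightarrow> finite {card I |I. I \<subseteq> pverts H \<and> indep I (uedges H)}"
  by (rule finite_subset[of _ "card ` Pow (pverts H)"]) (auto simp: simple_graph_iff)

lemma card_le_independence_number:
  "simple_graph H \<Longrightarrow> I \<subseteq> pverts H \<Longrightarrow> indep I (uedges H) \<Longrightarrow> card I \<le> independence_number H"
  unfolding independence_number_def by (rule Max_ge[OF finite_indep_cards]) auto

lemma independence_number_le:
  assumes "simple_graph H"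
    and "\<And>I. I \<subseteq> pverts H \<Longrightarrow> indep I (uedges H) \<Longrightarrow> card I \<le> n"
  shows "independence_number H \<le> n"
proof -
  \<comment> \<open>\<open>Max_le_iff\<close> needs a nonempty set of cardinalities; the empty
    independent set provides a member.\<close>
  have "indep {} (uedges H)"
    by (simp add: indep_def)
  then show ?thesis
    unfolding independence_number_def
    using assms by (subst Max_le_iff[OF finite_indep_cards]) auto
qed

text \<open>The tag \<open>i\<close> keeps the copies apart: the graphs \<open>H i\<close> live on
  one type and may share vertices.\<close>

definition join_fibre :: "'i set \<Rightarrow> ('i \<Rightarrow> 'a \<Rightarrow> 'b set) \<Rightarrow> 'a \<Rightarrow> ('i \<times> 'b) set" where
  "join_fibre I L u = (SIGMA i:I. L i u)"

text \<open>Between different components, the arcs are exactly those joining two fibres over the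
  same vertex. That vertex is restricted to \<open>V\<close> because \<open>L i\<close> is arbitrary
  elsewhere.\<close>

definition join_graph ::
  "'i set \<Rightarrow> 'a set \<Rightarrow> ('i \<Rightarrow> 'a \<Rightarrow> 'b set) \<Rightarrow> ('i \<Rightarrow> 'b pair_pre_digraph) \<Rightarrow> ('i \<times> 'b) pair_pre_digraph"
  where
  "join_graph I V L H = \<lparr>pverts = (SIGMA i:I. pverts (H i)),
     parcs = {((i, x), (j, y)) |i x j y. i \<in> I \<and> j \<in> I \<and>
       (if i = j then (x, y) \<in> parcs (H i) else \<exists>u\<in>V. x \<in> L i u \<and> y \<in> L j u)}\<rparr>"

context
  fixes G :: "'a pair_pre_digraph" and I :: "'i set" and t :: "'i \<Rightarrow> nat"
    and L :: "'i \<Rightarrow> 'a \<Rightarrow> 'b set" and H :: "'i \<Rightarrow> 'b pair_pre_digraph"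
  assumes G: "simple_graph G" and I: "finite I" "I \<noteq> {}"
    and fold: "\<And>i. i \<in> I \<Longrightarrow> fold_cover (t i) G (L i) (H i)"
begin

abbreviation (input) J where "J \<equiv> join_graph I (pverts G) L H"

lemma cover_component: "i \<in> I \<Longrightarrow> cover G (L i) (H i)"
  using fold by (simp add: fold_cover_def)

lemma simple_graph_component: "i \<in> I \<Longrightarrow> simple_graph (H i)"
  using cover_component by (simp add: cover_def)

lemma fibre_subset: "i \<in> I \<Longrightarrow> u \<in> pverts G \<Longrightarrow> L i u \<subseteq> pverts (H i)"
  using cover_component by (fastforce simp: cover_def)

lemma fibre_unique:
  "i \<in> I \<Longrightarrow> u \<in> pverts G \<Longrightarrow> v \<in> pverts G \<Longrightarrow> x \<in> L i u \<Longrightarrow> x \<in> L i v \<Longrightarrow> u = v"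
  using cover_component by (fastforce simp: cover_def disjoint_family_on_def)

lemma join_arc_iff: "((i, x), (j, y)) \<in> parcs J \<longleftrightarrow> i \<in> I \<and> j \<in> I \<and>
    (if i = j then (x, y) \<in> parcs (H i) else \<exists>u\<in>pverts G. x \<in> L i u \<and> y \<in> L j u)"
  by (simp add: join_graph_def)

lemma simple_graph_join: "simple_graph J"
proof -
  have "finite (pverts J)" "pverts J \<noteq> {}"
    using I simple_graph_component by (auto simp: join_graph_def simple_graph_iff)
  moreover have "parcs J \<subseteq> pverts J \<times> pverts J"
    using simple_graph_component fibre_subset
    by (fastforce simp: join_graph_def simple_graph_iff split: if_splits)
  moreover have "sym (parcs J)"
  proof -
    have "(y, x) \<in> parcs (H i)" if "i \<in> I" "(x, y) \<in> parcs (H i)" for i x y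
      using that simple_graph_component[of i] by (auto simp: simple_graph_iff dest: symD)
    then show ?thesis
      by (intro symI) (auto simp: join_arc_iff split: if_splits; blast)
  qed
  moreover have "irrefl (parcs J)"
    using simple_graph_component by (auto simp: join_arc_iff simple_graph_iff irrefl_def)
  ultimately show ?thesis
    by (simp add: simple_graph_iff)
qed

lemma uedges_join_same:
  "i \<in> I \<Longrightarrow> {(i, x), (i, y)} \<in> uedges J \<longleftrightarrow> {x, y} \<in> uedges (H i)"
  by (simp add: uedges_iff simple_graph_join simple_graph_component join_arc_iff)

lemma uedges_join_diff:
  "i \<in> I \<Longrightarrow> j \<in> I \<Longrightarrow> i \<noteq> j \<Longrightarrow>
    {(i, x), (j, y)} \<in> uedges J \<longleftrightarrow> (\<exists>u\<in>pverts G. x \<in> L i u \<and> y \<in> L j u)"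
  by (simp add: uedges_iff simple_graph_join join_arc_iff)

text \<open>An edge joining two different components stays over a single vertex of \<open>G\<close>,
  so an edge between fibres over distinct vertices must lie inside one component. This reduces both
  the matching condition and the no-edge condition to the given covers.\<close>

lemma edges_between_join:
  assumes uv: "u \<in> pverts G" "v \<in> pverts G" "u \<noteq> v"
    and e: "e \<in> edges_between J (join_fibre I L u) (join_fibre I L v)"
  shows "\<exists>i\<in>I. \<exists>d\<in>edges_between (H i) (L i u) (L i v). e = Pair i ` d"
proof -
  have e': "e \<in> uedges J" and meet: "e \<inter> join_fibre I L u \<noteq> {}" "e \<inter> join_fibre I L v \<noteq> {}"
    using e by (auto simp: edges_between_def)
  obtain i x where x: "(i, x) \<in> e" "i \<in> I" "x \<in> L i u"
    using meet by (auto simp: join_fibre_def)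
  obtain j y where y: "(j, y) \<in> e" "j \<in> I" "y \<in> L j v"
    using meet by (auto simp: join_fibre_def)
  \<comment> \<open>Equality would put \<open>x\<close> in the disjoint fibres \<open>L i u\<close>
    and \<open>L i v\<close>. Hence these two vertices are both ends of \<open>e\<close>.\<close>
  have "(i, x) \<noteq> (j, y)"
    using x y uv fibre_unique by blast
  then have eq: "e = {(i, x), (j, y)}"
    using e' x y by (auto simp: uedges_def)
  \<comment> \<open>Otherwise \<open>x\<close> and \<open>y\<close> lie over a common vertex of
    \<open>G\<close>, which by uniqueness of fibres equals both \<open>u\<close> and
    \<open>v\<close>.\<close>
  have "i = j"
    using e' x y uv fibre_unique unfolding eq by (metis uedges_join_diff)
  then have "{x, y} \<in> edges_between (H i) (L i u) (L i v)" "e = Pair i ` {x, y}"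
    using e' eq x y by (auto simp: edges_between_def uedges_join_same)
  with x show ?thesis
    by blast
qed

lemma cover_join: "cover G (join_fibre I L) J"
  unfolding cover_def
proof (intro conjI ballI allI impI)
  show "simple_graph J"
    by (rule simple_graph_join)
  have "(\<Union>u\<in>pverts G. L i u) = pverts (H i)" if "i \<in> I" for i
    using cover_component[OF that] by (simp add: cover_def)
  then show "(\<Union>u\<in>pverts G. join_fibre I L u) = pverts J"
    by (fastforce simp: join_fibre_def join_graph_def)
  show "disjoint_family_on (join_fibre I L) (pverts G)"
    using fibre_unique by (fastforce simp: disjoint_family_on_def join_fibre_def)
next
  fix u assume u: "u \<in> pverts G"
  have "{(i, x), (j, y)} \<in> uedges J"
    if "i \<in> I" "j \<in> I" "x \<in> L i u" "y \<in> L j u" "(i, x) \<noteq> (j, y)" for i x j y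
  proof (cases "i = j")
    case True
    then show ?thesis
      using that u cover_component[of i] by (auto simp: uedges_join_same cover_def clique_def)
  next
    case False
    then show ?thesis
      using that u by (auto simp: uedges_join_diff)
  qed
  then show "clique (join_fibre I L u) (uedges J)"
    by (fastforce simp: clique_def join_fibre_def)
next
  fix u v assume arc: "(u, v) \<in> parcs G"
  then have uv: "u \<in> pverts G" "v \<in> pverts G" "u \<noteq> v"
    using G by (auto simp: simple_graph_iff irrefl_def)
  show "disjoint (edges_between J (join_fibre I L u) (join_fibre I L v))"
  proof (rule disjointI)
    fix d e
    assume "d \<in> edges_between J (join_fibre I L u) (join_fibre I L v)"
      and "e \<in> edges_between J (join_fibre I L u) (join_fibre I L v)" and ne: "d \<noteq> e"
    then obtain i d' j e' where
      d: "i \<in> I" "d' \<in> edges_between (H i) (L i u) (L i v)" "d = Pair i ` d'" and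
      e: "j \<in> I" "e' \<in> edges_between (H j) (L j u) (L j v)" "e = Pair j ` e'"
      using edges_between_join[OF uv] by metis
    show "d \<inter> e = {}"
    \<comment> \<open>Within one component the edges are disjoint by the matching condition of that
      cover; edges of different components carry different tags.\<close>
    proof (cases "i = j")
      case True
      then have "d' \<noteq> e'" "disjoint (edges_between (H i) (L i u) (L i v))"
        using d e ne arc cover_component[of i] by (auto simp: cover_def)
      then have "d' \<inter> e' = {}"
        using True d e by (simp add: disjoint_def)
      then show ?thesis
        using d e by auto
    qed (use d e in auto)
  qed
next
  fix u v assume "u \<in> pverts G" "v \<in> pverts G" "u \<noteq> v \<and> (u, v) \<notin> parcs G"
  \<comment> \<open>Any such edge would come from an edge between \<open>L i u\<close> and
    \<open>L i v\<close> in some \<open>H i\<close>, and there is none.\<close>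
  then show "edges_between J (join_fibre I L u) (join_fibre I L v) = {}"
    using edges_between_join[of u v] cover_component by (fastforce simp: cover_def)
qed

lemma fold_cover_join: "fold_cover (\<Sum>i\<in>I. t i) G (join_fibre I L) J"
proof -
  have "card (join_fibre I L u) = (\<Sum>i\<in>I. t i)" if u: "u \<in> pverts G" for u
  proof -
    \<comment> \<open>Finiteness is drawn from \<open>H i\<close>, since
      \<open>card (L i u) = t i\<close> does not yield it when \<open>t i = 0\<close>.\<close>
    have "finite (L i u)" "card (L i u) = t i" if "i \<in> I" for i
      using that u finite_subset[OF fibre_subset[OF that u]] simple_graph_component[of i] fold[of i]
      by (auto simp: simple_graph_iff fold_cover_def)
    then show ?thesis
      using I by (simp add: join_fibre_def card_SigmaI)
  qed
  then show ?thesis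
    using cover_join by (simp add: fold_cover_def)
qed

text \<open>Each \<open>H i\<close> sits in the join as an induced subgraph, so the slice of an
  independent set at tag \<open>i\<close> is independent in \<open>H i\<close>; the slices' sizes
  add up.\<close>

lemma independence_number_join: "independence_number J \<le> (\<Sum>i\<in>I. independence_number (H i))"
proof (rule independence_number_le[OF simple_graph_join])
  fix S assume S: "S \<subseteq> pverts J" "indep S (uedges J)"
  have sub: "Pair i -` S \<subseteq> pverts (H i)" for i
    using S by (auto simp: join_graph_def)
  have "indep (Pair i -` S) (uedges (H i))" if "i \<in> I" for i
    using S that by (auto simp: indep_def simp flip: uedges_join_same)
  then have le: "card (Pair i -` S) \<le> independence_number (H i)" if "i \<in> I" for i
    using that sub simple_graph_component card_le_independence_number by blast
  have fin: "finite (Pair i -` S)" if "i \<in> I" for i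
    using that sub simple_graph_component finite_subset by (fastforce simp: simple_graph_iff)
  \<comment> \<open>All tags occurring in \<open>S\<close> belong to \<open>I\<close>, so no vertex
    is lost.\<close>
  have "S = (SIGMA i:I. Pair i -` S)"
    using S by (auto simp: join_graph_def)
  then have "card S = (\<Sum>i\<in>I. card (Pair i -` S))"
    using I fin by (metis card_SigmaI)
  also have "\<dots> \<le> (\<Sum>i\<in>I. independence_number (H i))"
    using le by (rule sum_mono)
  finally show "card S \<le> (\<Sum>i\<in>I. independence_number (H i))" .
qed

end

theorem lemma6:
  fixes G :: "'a pair_pre_digraph" and k :: nat and t :: "nat \<Rightarrow> nat"
  assumes "simple_graph G" and "k \<ge> 1" and "\<And>i. i \<in> {1..k} \<Longrightarrow> t i \<ge> 1"
  shows "partial_DP (\<Sum>i=1..k. t i) G \<le> (\<Sum>i=1..k. partial_DP (t i) G)"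
proof -
  \<comment> \<open>The bound \<open>t i \<ge> 1\<close> guarantees that a \<open>t i\<close>-fold
    cover exists, so that the minimum is attained.\<close>
  have "\<forall>i\<in>{1..k}. \<exists>(L :: 'a \<Rightarrow> nat set) H.
      fold_cover (t i) G L H \<and> independence_number H = partial_DP (t i) G"
    using assms partial_DP_attained by blast
  then obtain L :: "nat \<Rightarrow> 'a \<Rightarrow> nat set" and H where
    LH: "\<And>i. i \<in> {1..k} \<Longrightarrow> fold_cover (t i) G (L i) (H i)"
      "\<And>i. i \<in> {1..k} \<Longrightarrow> independence_number (H i) = partial_DP (t i) G"
    by metis
  have I: "finite {1..k}" "{1..k} \<noteq> {}"
    using assms by auto
  \<comment> \<open>The join has pairs of naturals as vertices, whereas \<open>partial_DP\<close>
    minimises over graphs on naturals; \<open>partial_DP_le\<close> bridges the two types.\<close>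
  have "partial_DP (\<Sum>i=1..k. t i) G
      \<le> independence_number (join_graph {1..k} (pverts G) L H)"
    using partial_DP_le[OF assms(1) fold_cover_join[OF assms(1) I LH(1)]] .
  also have "\<dots> \<le> (\<Sum>i=1..k. independence_number (H i))"
    using independence_number_join[OF assms(1) I LH(1)] .
  also have "\<dots> = (\<Sum>i=1..k. partial_DP (t i) G)"
    using LH(2) by simp
  finally show ?thesis .
qed

end
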